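(* A permutation $w$ is almost vexillary if and only if it avoids the patterns $13254$, $315264$, and $316254$.
   Context: Permutations are in one-line notation; $w$ contains a pattern $p\in S_k$ if some subsequence of $w$ of length $k$ has the same relative order as $p$, and avoids $p$ otherwise. Diagrams are subsets of $[n]\times[n]$, $(i,j)$ in row $i$ (top to bottom) and column $j$. Rothe diagram $D(w)=\{(i,j):i<w^{-1}(j),\ j<w(i)\}$. A missing tooth of $D$ is $(i,j)\notin D$ with $(i+1,j)\in D$; a column is packed if it has no missing tooth. $D_-(w)$ is obtained from $D(w)$ by deleting all squares lying in packed columns. For a weak composition $\alpha=(\alpha_1,\dots,\alpha_n)$, $D_{\mathrm{Sky}}(\alpha)=\{(i,j):1\le j\le\alpha_i\}$. $w\in S_n$ is almost vexillary if $D_-(w)=\{(i,\sigma(j)):(i,j)\in D_{\mathrm{Sky}}(\alpha)\}$ for some weak composition $\alpha$ and some permutation $\sigma$ of the columns. *)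

theory Defs
  imports "HOL-Combinatorics.Permutations" "HOL-Library.Sublist"
begin

text \<open>Elements of the symmetric group on n letters are functions with
  \<^term>\<open>w permutes {1..n}\<close>. A cell is a pair (row, column), both indexed from 1.\<close>

definition one_line :: "nat \<Rightarrow> (nat \<Rightarrow> nat) \<Rightarrow> nat list" where
  "one_line n w = map w [1..<Suc n]"

definition same_relative_order :: "nat list \<Rightarrow> nat list \<Rightarrow> bool" where
  "same_relative_order u p \<longleftrightarrow> length u = length p \<and>
     (\<forall>a < length p. \<forall>b < length p. u ! a < u ! b \<longleftrightarrow> p ! a < p ! b)"

text \<open>The pattern is given in one-line notation.\<close>

definition contains_pattern :: "nat \<Rightarrow> (nat \<Rightarrow> nat) \<Rightarrow> nat list \<Rightarrow> bool" where
  "contains_pattern n w p \<longleftrightarrow> (\<exists>u. subseq u (one_line n w) \<and> same_relative_order u p)"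

abbreviation avoids_pattern :: "nat \<Rightarrow> (nat \<Rightarrow> nat) \<Rightarrow> nat list \<Rightarrow> bool" where
  "avoids_pattern n w p \<equiv> \<not> contains_pattern n w p"

definition rothe_diagram :: "nat \<Rightarrow> (nat \<Rightarrow> nat) \<Rightarrow> (nat \<times> nat) set" where
  "rothe_diagram n w = {(i, j) \<in> {1..n} \<times> {1..n}. i < inv w j \<and> j < w i}"

text \<open>A missing tooth is itself a cell of the n by n grid. In particular its row is at
  least 1, so a column whose top cell is in D gets no missing tooth in row 0.\<close>

definition missing_tooth :: "nat \<Rightarrow> (nat \<times> nat) set \<Rightarrow> nat \<times> nat \<Rightarrow> bool" where
  "missing_tooth n D c \<longleftrightarrow> (case c of (i, j) \<Rightarrow>
     (i, j) \<in> {1..n} \<times> {1..n} \<and> (i, j) \<notin> D \<and> (i + 1, j) \<in> D)"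

definition packed_column :: "nat \<Rightarrow> (nat \<times> nat) set \<Rightarrow> nat \<Rightarrow> bool" where
  "packed_column n D j \<longleftrightarrow> (\<nexists>i. missing_tooth n D (i, j))"

definition reduced_rothe_diagram :: "nat \<Rightarrow> (nat \<Rightarrow> nat) \<Rightarrow> (nat \<times> nat) set" where
  "reduced_rothe_diagram n w =
     {(i, j) \<in> rothe_diagram n w. \<not> packed_column n (rothe_diagram n w) j}"

text \<open>Only the values of \<alpha> on 1, ..., n matter.\<close>

definition skyline_diagram :: "nat \<Rightarrow> (nat \<Rightarrow> nat) \<Rightarrow> (nat \<times> nat) set" where
  "skyline_diagram n \<alpha> = {(i, j). i \<in> {1..n} \<and> 1 \<le> j \<and> j \<le> \<alpha> i}"

text \<open>The bound on \<alpha> says that the skyline diagram is a diagram, i.e. lies in the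
  n by n grid on whose columns \<sigma> acts.\<close>

definition almost_vexillary :: "nat \<Rightarrow> (nat \<Rightarrow> nat) \<Rightarrow> bool" where
  "almost_vexillary n w \<longleftrightarrow> (\<exists>\<alpha> \<sigma>. (\<forall>i \<in> {1..n}. \<alpha> i \<le> n) \<and> \<sigma> permutes {1..n} \<and>
     reduced_rothe_diagram n w = {(i, \<sigma> j) | i j. (i, j) \<in> skyline_diagram n \<alpha>})"

end

theory Submission
  imports Defs
begin

text \<open>A diagram is a column rearrangement of a skyline diagram iff its columns form a chain
  under inclusion. In the Rothe diagram, the column of the value \<^term>\<open>w p\<close> is unpacked iff
  \<^term>\<open>w p\<close> plays the 2 in an occurrence of 132, and two columns are incomparable iff their values
  play the 1 and the 3 in an occurrence of 2143. If the 1 of a 2143 is the 2 of a 132, then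
  so is the 3. Hence \<^term>\<open>w\<close> fails to be almost vexillary iff the 1 of some 2143 is the 2 of some
  132; running through the relative orders of the two overlapping occurrences gives
  the three patterns.\<close>

section \<open>Pattern occurrences as increasing lists of positions\<close>

lemma subseq_upt_iff:
  "subseq xs [m..<n] \<longleftrightarrow> sorted_wrt (<) xs \<and> set xs \<subseteq> {m..<n}"
proof
  assume "subseq xs [m..<n]"
  then obtain N where "xs = nths [m..<n] N"
    by (auto simp: subseq_conv_nths)
  then show "sorted_wrt (<) xs \<and> set xs \<subseteq> {m..<n}"
    using set_nths_subset[of "[m..<n]" N] sorted_nths[of "[m..<n]" N] distinct_nthsI[of "[m..<n]" N]
    by (auto simp: strict_sorted_iff)
next
  assume xs: "sorted_wrt (<) xs \<and> set xs \<subseteq> {m..<n}"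
  \<comment> \<open>A strictly increasing list is determined by its set of entries, so filtering the
    interval by membership in \<open>set xs\<close> gives back \<open>xs\<close>, and a filtered
    list is a subsequence.\<close>
  have "xs = filter (\<lambda>x. x \<in> set xs) [m..<n]"
    by (rule sorted_distinct_set_unique) (use xs in \<open>auto simp: strict_sorted_iff sorted_wrt_filter\<close>)
  then show "subseq xs [m..<n]"
    by (metis subseq_filter_left)
qed

text \<open>Subsequences of the one-line notation are images under \<open>w\<close> of lists of
  positions. This lets an occurrence be described by inequalities between positions and between
  their values.\<close>

lemma contains_pattern_iff:
  "contains_pattern n w p \<longleftrightarrow>
    (\<exists>xs. sorted_wrt (<) xs \<and> set xs \<subseteq> {1..n} \<and> same_relative_order (map w xs) p)"
proof -
  have *: "subseq u (map w ys) \<longleftrightarrow> (\<exists>xs. subseq xs ys \<and> u = map w xs)" for u ys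
    by (auto simp: subseq_conv_nths nths_map)
  have "contains_pattern n w p \<longleftrightarrow>
    (\<exists>xs. subseq xs [1..<Suc n] \<and> same_relative_order (map w xs) p)"
    unfolding contains_pattern_def one_line_def * by blast
  then show ?thesis
    by (simp only: subseq_upt_iff atLeastLessThanSuc_atLeastAtMost conj_assoc)
qed

section \<open>Skyline diagrams up to column order, and chains of columns\<close>

lemma ex_permutation_sorting:
  fixes f :: "nat \<Rightarrow> nat"
  obtains \<sigma> where "\<sigma> permutes {1..n}"
    "\<And>j k. 1 \<le> j \<Longrightarrow> j \<le> k \<Longrightarrow> k \<le> n \<Longrightarrow> f (\<sigma> j) \<le> f (\<sigma> k)"
proof -
  define xs where "xs = sort_key f [1..<Suc n]"
  \<comment> \<open>List indices start at 0, hence the shift by one. Points outside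
    \<open>{1..n}\<close> are fixed, as \<open>permutes\<close> demands.\<close>
  define \<sigma> where "\<sigma> j = (if j \<in> {1..n} then xs ! (j - 1) else j)" for j
  have xs: "set xs = {1..n}" "distinct xs" "length xs = n" "sorted (map f xs)"
    by (auto simp: xs_def)
  have "bij_betw (\<lambda>j. xs ! (j - 1)) {1..n} {1..n}"
  proof -
    have "bij_betw (\<lambda>j. j - 1) {1..n} {..<n}"
      by (rule bij_betw_byWitness[where f' = Suc]) auto
    moreover have "bij_betw (nth xs) {..<n} {1..n}"
      using bij_betw_nth[of xs] xs by auto
    ultimately show ?thesis
      using bij_betw_trans by (fastforce simp: comp_def)
  qed
  then have "bij_betw \<sigma> {1..n} {1..n}"
    using bij_betw_cong[of "{1..n}" \<sigma> "\<lambda>j. xs ! (j - 1)"] by (simp add: \<sigma>_def)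
  then have "\<sigma> permutes {1..n}"
    by (rule bij_imp_permutes) (auto simp: \<sigma>_def)
  moreover have "f (\<sigma> j) \<le> f (\<sigma> k)" if "1 \<le> j" "j \<le> k" "k \<le> n" for j k
    using sorted_nth_mono[OF xs(4), of "j - 1" "k - 1"] that xs(3) by (simp add: \<sigma>_def)
  ultimately show ?thesis
    using that by blast
qed

text \<open>In a skyline diagram, column \<open>j\<close> consists of the rows \<open>i\<close> with
  \<open>j \<le> \<alpha> i\<close>, so columns shrink as \<open>j\<close> grows. Conversely, once
  the columns of a chain are sorted from largest to smallest, every row fills an initial segment of
  columns, and its length is the entry of \<open>\<alpha>\<close>.\<close>

lemma skyline_rearrangement_iff_chain:
  assumes D: "D \<subseteq> {1..n} \<times> {1..n}"
  shows "(\<exists>\<alpha> \<sigma>. (\<forall>i \<in> {1..n}. \<alpha> i \<le> n) \<and> \<sigma> permutes {1..n} \<and>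
      D = {(i, \<sigma> j) | i j. (i, j) \<in> skyline_diagram n \<alpha>}) \<longleftrightarrow>
    (\<forall>j k. {i. (i, j) \<in> D} \<subseteq> {i. (i, k) \<in> D} \<or> {i. (i, k) \<in> D} \<subseteq> {i. (i, j) \<in> D})"
    (is "?L \<longleftrightarrow> ?R")
proof
  assume ?L
  then obtain \<alpha> \<sigma> where \<sigma>: "\<sigma> permutes {1..n}"
    and D_eq: "D = {(i, \<sigma> j) | i j. (i, j) \<in> skyline_diagram n \<alpha>}"
    by blast
  \<comment> \<open>Each column is cut out by a threshold \<open>inv \<sigma> j\<close>, and the
    order of the thresholds decides the inclusion; threshold 0 gives the empty column.\<close>
  have "{i. (i, j) \<in> D} = {i \<in> {1..n}. 1 \<le> inv \<sigma> j \<and> inv \<sigma> j \<le> \<alpha> i}" for j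
    using permutes_inverses[OF \<sigma>] unfolding D_eq skyline_diagram_def by (auto; metis)
  then show ?R
    by (auto; metis le_trans nat_le_linear)
next
  assume chain: ?R
  define C where "C j = {i. (i, j) \<in> D}" for j
  have "C j \<subseteq> {1..n}" for j
    using D by (auto simp: C_def)
  then have fin: "finite (C j)" and card: "card (C j) \<le> n" for j
    using card_mono[of "{1..n}" "C j"] by (auto intro: finite_subset)
  \<comment> \<open>The key \<open>n - card\<close> turns ascending sorting into descending
    cardinality. The subtraction does not truncate since every column has at most \<open>n\<close>
    cells.\<close>
  obtain \<sigma> where \<sigma>: "\<sigma> permutes {1..n}"
    and sorted: "\<And>j k. 1 \<le> j \<Longrightarrow> j \<le> k \<Longrightarrow> k \<le> n \<Longrightarrow> n - card (C (\<sigma> j)) \<le> n - card (C (\<sigma> k))"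
    by (rule ex_permutation_sorting[of n "\<lambda>j. n - card (C j)"]) blast
  have mono: "C (\<sigma> k) \<subseteq> C (\<sigma> j)" if "1 \<le> j" "j \<le> k" "k \<le> n" for j k
  proof -
    have "card (C (\<sigma> k)) \<le> card (C (\<sigma> j))"
      using sorted[OF that] card[of "\<sigma> j"] card[of "\<sigma> k"] by linarith
    \<comment> \<open>If the chain condition yields the opposite inclusion, the comparison of
      cardinalities makes the two finite columns equal.\<close>
    then show ?thesis
      using chain card_seteq[OF fin, of "C (\<sigma> j)" "\<sigma> k"] unfolding C_def by blast
  qed
  define R where "R i = {j \<in> {1..n}. i \<in> C (\<sigma> j)}" for i
  define \<alpha> where "\<alpha> i = card (R i)" for i
  have R: "R i \<subseteq> {1..n}" for i
    by (auto simp: R_def)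
  have \<alpha>_le: "\<alpha> i \<le> n" for i
    using card_mono[OF _ R] by (simp add: \<alpha>_def)
  \<comment> \<open>\<open>R i\<close> is an initial segment by \<open>mono\<close>, and counting
    finds its end: a cell in column \<open>j\<close> puts \<open>{1..j}\<close> inside
    \<open>R i\<close>, a gap there leaves at most \<open>j - 1\<close> elements.\<close>
  have row: "i \<in> C (\<sigma> j) \<longleftrightarrow> j \<le> \<alpha> i" if j: "1 \<le> j" "j \<le> n" for i j
  proof
    assume i: "i \<in> C (\<sigma> j)"
    have "{1..j} \<subseteq> R i"
    proof
      fix k assume "k \<in> {1..j}"
      with i j mono[of k j] show "k \<in> R i"
        by (auto simp: R_def)
    qed
    then show "j \<le> \<alpha> i"
      using card_mono[of "R i" "{1..j}"] finite_subset[OF R] by (simp add: \<alpha>_def)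
  next
    assume le: "j \<le> \<alpha> i"
    show "i \<in> C (\<sigma> j)"
    proof (rule ccontr)
      assume i: "i \<notin> C (\<sigma> j)"
      have "R i \<subseteq> {1..<j}"
      proof
        fix k assume k: "k \<in> R i"
        with i mono[of j k] j have "\<not> j \<le> k"
          by (auto simp: R_def)
        with k R show "k \<in> {1..<j}"
          by fastforce
      qed
      then have "\<alpha> i \<le> j - 1"
        using card_mono[of "{1..<j}" "R i"] by (simp add: \<alpha>_def)
      with le j show False by simp
    qed
  qed
  have "D = {(i, \<sigma> j) | i j. (i, j) \<in> skyline_diagram n \<alpha>}"
  proof (intro set_eqI, safe)
    fix i k assume ik: "(i, k) \<in> D"
    then have "inv \<sigma> k \<in> {1..n}"
      using D permutes_in_image[OF permutes_inv[OF \<sigma>]] by blast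
    with ik D row[of "inv \<sigma> k" i] show "\<exists>i' j. (i, k) = (i', \<sigma> j) \<and> (i', j) \<in> skyline_diagram n \<alpha>"
      by (auto simp: permutes_inverses[OF \<sigma>] skyline_diagram_def C_def
          intro!: exI[of _ "inv \<sigma> k"])
  next
    fix i j assume "(i, j) \<in> skyline_diagram n \<alpha>"
    then have "i \<in> C (\<sigma> j)"
      using row[of j i] \<alpha>_le[of i] by (auto simp: skyline_diagram_def)
    then show "(i, \<sigma> j) \<in> D" by (simp add: C_def)
  qed
  with \<sigma> have "(\<forall>i \<in> {1..n}. \<alpha> i \<le> n) \<and> \<sigma> permutes {1..n} \<and>
      D = {(i, \<sigma> j) | i j. (i, j) \<in> skyline_diagram n \<alpha>}"
    by (intro conjI ballI \<alpha>_le)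
  then have "\<exists>\<sigma>. (\<forall>i \<in> {1..n}. \<alpha> i \<le> n) \<and> \<sigma> permutes {1..n} \<and>
      D = {(i, \<sigma> j) | i j. (i, j) \<in> skyline_diagram n \<alpha>}"
    by (rule exI[of _ \<sigma>])
  then show ?L
    by (rule exI[of _ \<alpha>])
qed

section \<open>Columns of the reduced Rothe diagram of a permutation\<close>

context
  fixes n :: nat and w :: "nat \<Rightarrow> nat"
  assumes w: "w permutes {1..n}"
begin

text \<open>Naming a column by the position \<open>p\<close> of its value replaces
  \<open>inv w\<close> by \<open>p\<close>. Every column has such a name because \<open>w\<close> is
  surjective.\<close>

lemma rothe_diagram_iff:
  "(i, w p) \<in> rothe_diagram n w \<longleftrightarrow> p \<in> {1..n} \<and> 1 \<le> i \<and> i < p \<and> w p < w i"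
  using permutes_in_image[OF w, of p] by (auto simp: rothe_diagram_def permutes_inverses[OF w])

text \<open>A missing tooth in row \<open>i\<close> is a 132 whose first two positions are
  \<open>i\<close> and \<open>i + 1\<close>. An arbitrary 132 yields one of these: on the way from
  \<open>x\<close> to \<open>y\<close> the values pass from below \<open>w p\<close> to above it,
  and they never equal \<open>w p\<close> since \<open>y < p\<close>, so some single step jumps over
  it.\<close>

lemma unpacked_column_iff:
  "\<not> packed_column n (rothe_diagram n w) (w p) \<longleftrightarrow>
    (\<exists>x y. 1 \<le> x \<and> x < y \<and> y < p \<and> p \<le> n \<and> w x < w p \<and> w p < w y)" (is "?L \<longleftrightarrow> ?R")
proof
  assume ?L
  then obtain i where i: "(i, w p) \<in> {1..n} \<times> {1..n}" "(i, w p) \<notin> rothe_diagram n w"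
      "(i + 1, w p) \<in> rothe_diagram n w"
    by (auto simp: packed_column_def missing_tooth_def)
  then have *: "p \<in> {1..n}" "1 \<le> i" "i + 1 < p" "w p < w (i + 1)" "\<not> w p < w i"
    by (auto simp: rothe_diagram_iff)
  then have "w i \<noteq> w p"
    by (simp add: inj_eq[OF permutes_inj[OF w]])
  with * have "1 \<le> i \<and> i < i + 1 \<and> i + 1 < p \<and> p \<le> n \<and> w i < w p \<and> w p < w (i + 1)"
    by auto
  then show ?R by blast
next
  assume ?R
  then obtain x y where xy: "1 \<le> x" "x < y" "y < p" "p \<le> n" "w x < w p" "w p < w y"
    by blast
  have "\<exists>i. x \<le> i \<and> i < y \<and> w i < w p \<and> w p < w (Suc i)"
  proof (rule ccontr)
    assume none: "\<not> ?thesis"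
    have "k \<le> y \<longrightarrow> w k < w p" if "x \<le> k" for k
      using that
    proof (induction k rule: dec_induct)
      case (step k)
      have "w (Suc k) \<noteq> w p" if "Suc k \<le> y"
        using xy that by (simp add: inj_eq[OF permutes_inj[OF w]])
      with none step show ?case by fastforce
    qed (use xy in simp)
    from this[of y] xy show False by simp
  qed
  then obtain i where "x \<le> i" "i < y" "w i < w p" "w p < w (Suc i)"
    by blast
  moreover have "w p \<in> {1..n}"
    using permutes_in_image[OF w, of p] xy by simp
  ultimately have "missing_tooth n (rothe_diagram n w) (i, w p)"
    using xy by (auto simp: missing_tooth_def rothe_diagram_iff)
  then show ?L by (auto simp: packed_column_def)
qed

lemma reduced_rothe_diagram_iff:
  "(i, w p) \<in> reduced_rothe_diagram n w \<longleftrightarrow> 1 \<le> i \<and> i < p \<and> w p < w i \<and>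
    (\<exists>x y. 1 \<le> x \<and> x < y \<and> y < p \<and> p \<le> n \<and> w x < w p \<and> w p < w y)"
  using rothe_diagram_iff[of i p] unpacked_column_iff[of p]
  by (auto simp: reduced_rothe_diagram_def)

lemma almost_vexillary_iff_chain:
  "almost_vexillary n w \<longleftrightarrow>
    (\<forall>p q. {i. (i, w p) \<in> reduced_rothe_diagram n w} \<subseteq> {i. (i, w q) \<in> reduced_rothe_diagram n w} \<or>
      {i. (i, w q) \<in> reduced_rothe_diagram n w} \<subseteq> {i. (i, w p) \<in> reduced_rothe_diagram n w})"
proof -
  have grid: "reduced_rothe_diagram n w \<subseteq> {1..n} \<times> {1..n}"
    by (auto simp: reduced_rothe_diagram_def rothe_diagram_def)
  have surj: "\<exists>p. j = w p" for j
    using permutes_surj[OF w] by blast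
  show ?thesis
    unfolding almost_vexillary_def skyline_rearrangement_iff_chain[OF grid] by (metis surj)
qed

text \<open>Here \<open>w p\<close> and \<open>w q\<close> are the two incomparable columns, and
  \<open>i\<close> and \<open>k\<close> are rows in which one has a cell and the other has none. The
  positions \<open>x\<close>, \<open>y\<close> witness that column \<open>w p\<close> is
  unpacked.\<close>

lemma not_almost_vexillary_iff:
  "\<not> almost_vexillary n w \<longleftrightarrow>
    (\<exists>x y i p k q. 1 \<le> x \<and> x < y \<and> y < p \<and> w x < w p \<and> w p < w y \<and>
      1 \<le> i \<and> i < p \<and> p < k \<and> k < q \<and> q \<le> n \<and> w p < w i \<and> w i < w q \<and> w q < w k)"
    (is "_ \<longleftrightarrow> ?R")
proof
  let ?C = "\<lambda>p. {i. (i, w p) \<in> reduced_rothe_diagram n w}"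
  assume "\<not> almost_vexillary n w"
  then obtain p q where pq: "\<not> ?C p \<subseteq> ?C q" "\<not> ?C q \<subseteq> ?C p"
    unfolding almost_vexillary_iff_chain by blast
  \<comment> \<open>By symmetry the column with the smaller value may be called
    \<open>w p\<close>.\<close>
  have *: ?R if lt: "w p < w q" and pq: "\<not> ?C p \<subseteq> ?C q" "\<not> ?C q \<subseteq> ?C p" for p q
  proof -
    obtain i k where i: "i \<in> ?C p" "i \<notin> ?C q" and k: "k \<in> ?C q" "k \<notin> ?C p"
      using pq by blast
    obtain x y where xy: "1 \<le> x" "x < y" "y < p" "w x < w p" "w p < w y"
      and i': "1 \<le> i" "i < p" "w p < w i"
      using i(1) by (auto simp: reduced_rothe_diagram_iff)
    have k': "1 \<le> k" "k < q" "w q < w k" "q \<le> n"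
      using k(1) by (auto simp: reduced_rothe_diagram_iff)
    \<comment> \<open>Otherwise \<open>w p < w q < w k\<close> would put row \<open>k\<close> into
      the unpacked column \<open>w p\<close>.\<close>
    have "\<not> k < p"
      using k(2) i(1) k' lt by (auto simp: reduced_rothe_diagram_iff)
    moreover have "k \<noteq> p"
      using k' lt by auto
    ultimately have "p < k" by simp
    \<comment> \<open>Otherwise \<open>i < p < k < q\<close> would put row \<open>i\<close> into
      column \<open>w q\<close>, which is unpacked because it contains row \<open>k\<close>.\<close>
    moreover have "\<not> w q < w i"
      using i(2) k(1) i' k' \<open>p < k\<close> by (auto simp: reduced_rothe_diagram_iff)
    moreover have "w i \<noteq> w q"
      using i' k' \<open>p < k\<close> by (simp add: inj_eq[OF permutes_inj[OF w]])
    ultimately have "w i < w q" "p < k" by auto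
    with xy i' k' show ?R by blast
  qed
  have "w p \<noteq> w q"
    using pq by auto
  then consider "w p < w q" | "w q < w p"
    by linarith
  then show ?R
  proof cases
    case 1
    then show ?thesis by (rule *[OF _ pq])
  next
    case 2
    then show ?thesis by (rule *[OF _ pq(2,1)])
  qed
next
  assume ?R
  then obtain x y i p k q where *: "1 \<le> x" "x < y" "y < p" "w x < w p" "w p < w y"
      "1 \<le> i" "i < p" "p < k" "k < q" "q \<le> n" "w p < w i" "w i < w q" "w q < w k"
    by blast
  have "(i, w p) \<in> reduced_rothe_diagram n w"
    unfolding reduced_rothe_diagram_iff
    by (intro conjI, (use * in linarith)+, rule exI[of _ x], rule exI[of _ y], use * in linarith)
  \<comment> \<open>The 132 at \<open>x\<close>, \<open>k\<close>, \<open>q\<close> makes column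
    \<open>w q\<close> unpacked, since \<open>w x < w p < w q < w k\<close>.\<close>
  moreover have "(k, w q) \<in> reduced_rothe_diagram n w"
    unfolding reduced_rothe_diagram_iff
    by (intro conjI, (use * in linarith)+, rule exI[of _ x], rule exI[of _ k], use * in linarith)
  moreover have "(i, w q) \<notin> reduced_rothe_diagram n w" "(k, w p) \<notin> reduced_rothe_diagram n w"
    using * by (simp_all add: reduced_rothe_diagram_iff)
  ultimately show "\<not> almost_vexillary n w"
    unfolding almost_vexillary_iff_chain by blast
qed

end

section \<open>The three patterns as chains of inequalities\<close>

lemma same_relative_order_13254_iff:
  "same_relative_order [a, b, c, d, e] [1, 3, 2, 5, 4] \<longleftrightarrow>
    a < c \<and> c < b \<and> b < e \<and> e < d"
  \<comment> \<open>Comparing the letters that carry consecutive values of the pattern settles all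
    other pairs by transitivity.\<close>
  unfolding same_relative_order_def by (simp add: All_less_Suc2, safe; linarith)

lemma contains_13254_iff:
  "contains_pattern n w [1, 3, 2, 5, 4] \<longleftrightarrow>
    (\<exists>a b c d e. 1 \<le> a \<and> a < b \<and> b < c \<and> c < d \<and> d < e \<and> e \<le> n \<and>
      w a < w c \<and> w c < w b \<and> w b < w e \<and> w e < w d)" (is "?L \<longleftrightarrow> ?R")
proof
  assume ?L
  then obtain xs where xs: "sorted_wrt (<) xs" "set xs \<subseteq> {1..n}"
      "same_relative_order (map w xs) [1, 3, 2, 5, 4]"
    unfolding contains_pattern_iff by blast
  then have "length xs = 5"
    by (simp add: same_relative_order_def)
  then obtain a b c d e where "xs = [a, b, c, d, e]"
    by (auto simp: length_Suc_conv numeral_eq_Suc)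
  with xs have "1 \<le> a \<and> a < b \<and> b < c \<and> c < d \<and> d < e \<and> e \<le> n \<and>
      w a < w c \<and> w c < w b \<and> w b < w e \<and> w e < w d"
    by (simp add: same_relative_order_13254_iff del: One_nat_def)
  then show ?R
    by blast
next
  assume ?R
  then obtain a b c d e where "1 \<le> a \<and> a < b \<and> b < c \<and> c < d \<and> d < e \<and> e \<le> n \<and>
      w a < w c \<and> w c < w b \<and> w b < w e \<and> w e < w d"
    by blast
  then show ?L
    unfolding contains_pattern_iff
    by (intro exI[of _ "[a, b, c, d, e]"]) (simp add: same_relative_order_13254_iff del: One_nat_def)
qed

lemma same_relative_order_315264_iff:
  "same_relative_order [a, b, c, d, e, f] [3, 1, 5, 2, 6, 4] \<longleftrightarrow>
    b < d \<and> d < a \<and> a < f \<and> f < c \<and> c < e"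
  unfolding same_relative_order_def by (simp add: All_less_Suc2, safe; linarith)

lemma contains_315264_iff:
  "contains_pattern n w [3, 1, 5, 2, 6, 4] \<longleftrightarrow>
    (\<exists>a b c d e f. 1 \<le> a \<and> a < b \<and> b < c \<and> c < d \<and> d < e \<and> e < f \<and> f \<le> n \<and>
      w b < w d \<and> w d < w a \<and> w a < w f \<and> w f < w c \<and> w c < w e)" (is "?L \<longleftrightarrow> ?R")
proof
  assume ?L
  then obtain xs where xs: "sorted_wrt (<) xs" "set xs \<subseteq> {1..n}"
      "same_relative_order (map w xs) [3, 1, 5, 2, 6, 4]"
    unfolding contains_pattern_iff by blast
  then have "length xs = 6"
    by (simp add: same_relative_order_def)
  then obtain a b c d e f where "xs = [a, b, c, d, e, f]"
    by (auto simp: length_Suc_conv numeral_eq_Suc)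
  with xs have "1 \<le> a \<and> a < b \<and> b < c \<and> c < d \<and> d < e \<and> e < f \<and> f \<le> n \<and>
      w b < w d \<and> w d < w a \<and> w a < w f \<and> w f < w c \<and> w c < w e"
    by (simp add: same_relative_order_315264_iff del: One_nat_def)
  then show ?R
    by blast
next
  assume ?R
  then obtain a b c d e f where "1 \<le> a \<and> a < b \<and> b < c \<and> c < d \<and> d < e \<and> e < f \<and> f \<le> n \<and>
      w b < w d \<and> w d < w a \<and> w a < w f \<and> w f < w c \<and> w c < w e"
    by blast
  then show ?L
    unfolding contains_pattern_iff
    by (intro exI[of _ "[a, b, c, d, e, f]"]) (simp add: same_relative_order_315264_iff del: One_nat_def)
qed

lemma same_relative_order_316254_iff:
  "same_relative_order [a, b, c, d, e, f] [3, 1, 6, 2, 5, 4] \<longleftrightarrow>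
    b < d \<and> d < a \<and> a < f \<and> f < e \<and> e < c"
  unfolding same_relative_order_def by (simp add: All_less_Suc2, safe; linarith)

lemma contains_316254_iff:
  "contains_pattern n w [3, 1, 6, 2, 5, 4] \<longleftrightarrow>
    (\<exists>a b c d e f. 1 \<le> a \<and> a < b \<and> b < c \<and> c < d \<and> d < e \<and> e < f \<and> f \<le> n \<and>
      w b < w d \<and> w d < w a \<and> w a < w f \<and> w f < w e \<and> w e < w c)" (is "?L \<longleftrightarrow> ?R")
proof
  assume ?L
  then obtain xs where xs: "sorted_wrt (<) xs" "set xs \<subseteq> {1..n}"
      "same_relative_order (map w xs) [3, 1, 6, 2, 5, 4]"
    unfolding contains_pattern_iff by blast
  then have "length xs = 6"
    by (simp add: same_relative_order_def)
  then obtain a b c d e f where "xs = [a, b, c, d, e, f]"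
    by (auto simp: length_Suc_conv numeral_eq_Suc)
  with xs have "1 \<le> a \<and> a < b \<and> b < c \<and> c < d \<and> d < e \<and> e < f \<and> f \<le> n \<and>
      w b < w d \<and> w d < w a \<and> w a < w f \<and> w f < w e \<and> w e < w c"
    by (simp add: same_relative_order_316254_iff del: One_nat_def)
  then show ?R
    by blast
next
  assume ?R
  then obtain a b c d e f where "1 \<le> a \<and> a < b \<and> b < c \<and> c < d \<and> d < e \<and> e < f \<and> f \<le> n \<and>
      w b < w d \<and> w d < w a \<and> w a < w f \<and> w f < w e \<and> w e < w c"
    by blast
  then show ?L
    unfolding contains_pattern_iff
    by (intro exI[of _ "[a, b, c, d, e, f]"]) (simp add: same_relative_order_316254_iff del: One_nat_def)
qed

section \<open>Overlaps of a 132 with a 2143\<close>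

theorem theorem5p1:
  fixes n :: nat and w :: "nat \<Rightarrow> nat"
  assumes "w permutes {1..n}"
  shows "almost_vexillary n w \<longleftrightarrow>
    avoids_pattern n w [1, 3, 2, 5, 4] \<and>
    avoids_pattern n w [3, 1, 5, 2, 6, 4] \<and>
    avoids_pattern n w [3, 1, 6, 2, 5, 4]"
proof -
  have "\<not> almost_vexillary n w \<longleftrightarrow> contains_pattern n w [1, 3, 2, 5, 4] \<or>
    contains_pattern n w [3, 1, 5, 2, 6, 4] \<or> contains_pattern n w [3, 1, 6, 2, 5, 4]"
    (is "?L \<longleftrightarrow> ?R")
  proof
    assume ?L
    then obtain x y i p k q where *: "1 \<le> x" "x < y" "y < p" "w x < w p" "w p < w y"
        "1 \<le> i" "i < p" "p < k" "k < q" "q \<le> n" "w p < w i" "w i < w q" "w q < w k"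
      unfolding not_almost_vexillary_iff[OF assms] by blast
    have "i \<noteq> x"
      using * by auto
    have "w y \<noteq> w q" "w y \<noteq> w k"
      using * by (simp_all add: inj_eq[OF permutes_inj[OF assms]])
    \<comment> \<open>If \<open>x < i\<close>, then \<open>x, i, p, k, q\<close> is a 13254; if
      \<open>w y < w q\<close>, then \<open>x, y, p, k, q\<close> is one. Otherwise
      \<open>i, x, y, p, k, q\<close> is an occurrence of length six, and whether \<open>w y\<close>
      lies below or above \<open>w k\<close> decides between 315264 and 316254.\<close>
    then consider "x < i" | "w y < w q" | "i < x" "w q < w y" "w y < w k" | "i < x" "w k < w y"
      using \<open>i \<noteq> x\<close> by linarith
    then show ?R
    proof cases
      case 1
      with * have "contains_pattern n w [1, 3, 2, 5, 4]"
        unfolding contains_13254_iff by blast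
      then show ?thesis by blast
    next
      case 2
      with * have "contains_pattern n w [1, 3, 2, 5, 4]"
        unfolding contains_13254_iff by blast
      then show ?thesis by blast
    next
      case 3
      with * have "contains_pattern n w [3, 1, 5, 2, 6, 4]"
        unfolding contains_315264_iff by blast
      then show ?thesis by blast
    next
      case 4
      with * have "contains_pattern n w [3, 1, 6, 2, 5, 4]"
        unfolding contains_316254_iff by blast
      then show ?thesis by blast
    qed
  next
    assume ?R
    then show ?L
    proof (elim disjE)
      assume "contains_pattern n w [1, 3, 2, 5, 4]"
      then obtain a b c d e where "1 \<le> a" "a < b" "b < c" "c < d" "d < e" "e \<le> n"
          "w a < w c" "w c < w b" "w b < w e" "w e < w d"
        unfolding contains_13254_iff by blast
      \<comment> \<open>The letter 3, at position \<open>b\<close>, serves both as the 3 of the 132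
        and as the 2 of the 2143.\<close>
      then have "1 \<le> a \<and> a < b \<and> b < c \<and> w a < w c \<and> w c < w b \<and>
        1 \<le> b \<and> b < c \<and> c < d \<and> d < e \<and> e \<le> n \<and> w c < w b \<and> w b < w e \<and> w e < w d"
        by linarith
      then show ?L
        unfolding not_almost_vexillary_iff[OF assms] by blast
    next
      assume "contains_pattern n w [3, 1, 5, 2, 6, 4]"
      then obtain a b c d e f where "1 \<le> a" "a < b" "b < c" "c < d" "d < e" "e < f" "f \<le> n"
          "w b < w d" "w d < w a" "w a < w f" "w f < w c" "w c < w e"
        unfolding contains_315264_iff by blast
      \<comment> \<open>The 132 sits at \<open>b, c, d\<close> and the 2143 at
        \<open>a, d, e, f\<close>. The same positions work for 316254, where only the order of
        \<open>w c\<close> and \<open>w e\<close> changes.\<close>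
      then have "1 \<le> b \<and> b < c \<and> c < d \<and> w b < w d \<and> w d < w c \<and>
        1 \<le> a \<and> a < d \<and> d < e \<and> e < f \<and> f \<le> n \<and> w d < w a \<and> w a < w f \<and> w f < w e"
        by linarith
      then show ?L
        unfolding not_almost_vexillary_iff[OF assms] by blast
    next
      assume "contains_pattern n w [3, 1, 6, 2, 5, 4]"
      then obtain a b c d e f where "1 \<le> a" "a < b" "b < c" "c < d" "d < e" "e < f" "f \<le> n"
          "w b < w d" "w d < w a" "w a < w f" "w f < w e" "w e < w c"
        unfolding contains_316254_iff by blast
      then have "1 \<le> b \<and> b < c \<and> c < d \<and> w b < w d \<and> w d < w c \<and>
        1 \<le> a \<and> a < d \<and> d < e \<and> e < f \<and> f \<le> n \<and> w d < w a \<and> w a < w f \<and> w f < w e"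
        by linarith
      then show ?L
        unfolding not_almost_vexillary_iff[OF assms] by blast
    qed
  qed
  then show ?thesis by blast
qed

end
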